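(* Let $U \subset \mathbb{A}^3_{\mathbb{Q}}$ be the affine cubic surface with coordinates $(y,u,z)$ defined by $2uyz = y^2 - 3u^2 - 1$. Assume the Browning–Wilsch conjecture holds for $U$, namely that $N_U^\circ(B) \ll_U (\log B)^{\rho_U + b}$ as $B \to \infty$ (for this surface $\rho_U = 2$ and $b = 2$, so the assumption reads $N_U^\circ(B) \ll (\log B)^4$). Then, for $Z\ge 2$, $$\sum_{\substack{1\le z \leq Z,\ 3 \nmid z \\ \mu^2(z^2+3) = 1}} h(z^2 + 3) \ll Z^{\frac95} (\log Z)^{\frac35}.$$
   Context: $\mu$ is the Möbius function, so $\mu^2(n)=1$ means $n$ is square-free. For an integer $d$, $h(d)$ is the class number of quadratic forms of determinant $d$ (in Gauss's sense): the number of properly primitive classes of indefinite binary forms $ax^2 + 2bxy + cy^2$ with $b^2 - ac = d$. An $\mathbb{A}^1$-curve on $U$ defined over $\mathbb{Z}$ is the image of a non-constant polynomial map $s \mapsto (y(s),u(s),z(s))$ with $y,u,z \in \mathbb{Z}[s]$ whose image lies in $U$. $U(\mathbb{Z})^\circ$ is the set of integer points of $U$ not lying on any $\mathbb{A}^1$-curve defined over $\mathbb{Z}$, and $N_U^\circ(B) = \#\{(y,u,z) \in U(\mathbb{Z})^\circ : \max(|y|,|u|,|z|) \leq B\}$. In the Browning–Wilsch conjecture, $X$ is the closure of $U$ in $\mathbb{P}^3_{\mathbb{Q}}$, $\tilde X \to X$ is a morphism from a smooth projective surface which is an isomorphism over $U$ and such that $\tilde D = \tilde X \setminus U$ is a strict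 normal crossings divisor with class $\omega_{\tilde X}^\vee$; $\rho_U$ is the Picard number of $U$ over $\mathbb{Q}$ and $b$ is the maximal number of components of $\tilde D(\mathbb{R})$ that share a real point. *)

theory Defs
  imports
    Complex_Main
    "HOL-Library.Landau_Symbols"
    "HOL-Computational_Algebra.Computational_Algebra"
begin

text \<open>
  A triple \<open>(a, b, c)\<close> stands for the form \<open>a x\<^sup>2 + 2 b x y + c y\<^sup>2\<close> (even middle coefficient,
  as in Gauss), whose determinant is \<open>b\<^sup>2 - a c\<close>.
\<close>

type_synonym bqf = "int \<times> int \<times> int"

fun form_value :: "bqf \<Rightarrow> int \<Rightarrow> int \<Rightarrow> int" where
  "form_value (a, b, c) x y = a * x\<^sup>2 + 2 * b * x * y + c * y\<^sup>2"

fun form_det :: "bqf \<Rightarrow> int" where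
  "form_det (a, b, c) = b\<^sup>2 - a * c"

text \<open>Properly primitive means \<open>gcd a (2 b) c = 1\<close>, which is stronger than \<open>gcd a b c = 1\<close>.\<close>

fun properly_primitive :: "bqf \<Rightarrow> bool" where
  "properly_primitive (a, b, c) \<longleftrightarrow> gcd a (gcd (2 * b) c) = 1"

definition indefinite :: "bqf \<Rightarrow> bool" where
  "indefinite f \<longleftrightarrow> (\<exists>x y. form_value f x y > 0) \<and> (\<exists>x y. form_value f x y < 0)"

text \<open>
  Gauss's classes are those of proper equivalence: only substitutions of determinant \<open>1\<close>
  (not \<open>-1\<close>) are admitted.
\<close>

definition properly_equivalent :: "(bqf \<times> bqf) set" where
  "properly_equivalent = {(f, g). \<exists>p q r s :: int. p * s - q * r = 1 \<and>
     (\<forall>x y. form_value g x y = form_value f (p * x + q * y) (r * x + s * y))}"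

definition class_number :: "int \<Rightarrow> nat" where
  "class_number d =
     card ({f. form_det f = d \<and> properly_primitive f \<and> indefinite f} // properly_equivalent)"

text \<open>The points of \<open>U\<close> with coordinates \<open>(y, u, z)\<close> in an arbitrary commutative ring.\<close>

definition U_points :: "('a::comm_ring_1 \<times> 'a \<times> 'a) set" where
  "U_points = {(y, u, z). 2 * u * y * z = y\<^sup>2 - 3 * u\<^sup>2 - 1}"

text \<open>
  The polynomials have integer coefficients, but the image is that of the whole affine line, so
  the parameter runs through the complex numbers. An integer point lying on the curve need not be
  the value at an integer parameter.
\<close>

definition A1_curve :: "(complex \<times> complex \<times> complex) set \<Rightarrow> bool" where
  "A1_curve C \<longleftrightarrow> (\<exists>y u z :: int poly.
     \<not> (degree y = 0 \<and> degree u = 0 \<and> degree z = 0) \<and>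
     C = range (\<lambda>s. (poly (map_poly of_int y) s, poly (map_poly of_int u) s,
                     poly (map_poly of_int z) s)) \<and>
     C \<subseteq> U_points)"

definition U_circ :: "(int \<times> int \<times> int) set" where
  "U_circ = {(y, u, z) \<in> U_points.
     \<not> (\<exists>C. A1_curve C \<and> (of_int y, of_int u, of_int z) \<in> C)}"

definition N_U_circ :: "real \<Rightarrow> nat" where
  "N_U_circ B = card {(y, u, z) \<in> U_circ. real_of_int (max \<bar>y\<bar> (max \<bar>u\<bar> \<bar>z\<bar>)) \<le> B}"

text \<open>
  The conjectural bound has exponent \<open>\<rho>\<^sub>U + b\<close>, where \<open>\<rho>\<^sub>U\<close> is the Picard number of \<open>U\<close> over the
  rationals and \<open>b\<close> is the maximal number of components of the boundary divisor of a resolution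
  of the projective closure of \<open>U\<close> that share a real point. For this surface both are \<open>2\<close>;
  neither invariant is formalised here.
\<close>

definition Browning_Wilsch_for_U :: bool where
  "Browning_Wilsch_for_U \<longleftrightarrow> (\<lambda>B. real (N_U_circ B)) \<in> O[at_top](\<lambda>B. ln B ^ (2 + 2))"

end

theory Submission imports Defs begin

text \<open>
  Let \<open>d = z\<^sup>2 + 3\<close>. The forms \<open>(a, b, c)\<close> of determinant \<open>d\<close> with \<open>a > 0 > c\<close> are at most
  \<open>d powr (1 / 2 + e)\<close> in number, by the divisor bound, and each class runs through them
  periodically. If Pell's equation \<open>x\<^sup>2 - d u\<^sup>2 = 1\<close> has no solution with \<open>u \<noteq> 0\<close> and
  \<open>x \<le> 2 ^ n\<close>, then every period exceeds \<open>n\<close>, so that the class number is at most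
  \<open>d powr (1 / 2 + e) / (n + 1)\<close>. A solution, on the other hand, is an integer point
  \<open>(x + z u, u, z)\<close> on \<open>U\<close>, and it lies on no curve if \<open>z\<close> is prime to \<open>3\<close>, because on the
  curves \<open>x + u \<surd>d\<close> is a power of \<open>(z + \<surd>d)\<^sup>2 / 3\<close> up to sign. So by hypothesis at most
  \<open>O(n ^ 4)\<close> values of \<open>z\<close> admit a solution with \<open>x \<le> 2 ^ n\<close>. Treating separately the \<open>z\<close> whose
  least solution has size \<open>n\<close> below \<open>Z powr (3/20)\<close>, between that and \<open>Z powr (9/40)\<close>, and above,
  one finds \<open>O(Z powr (71/40 + 2 e))\<close> for the sum, and \<open>71/40 < 9/5\<close>.
\<close>

subsection \<open>Integer points on polynomial curves\<close>

text \<open>The descent below divides by \<open>3\<close>, so integrality of the coefficients is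
  lost on the way. Realness survives, and it is what rules out
  \<open>3 * u\<^sup>2 = - 1\<close>.\<close>

definition real_coeffs :: "complex poly \<Rightarrow> bool" where
  "real_coeffs p \<longleftrightarrow> (\<forall>i. coeff p i \<in> \<real>)"

lemma real_coeffs_diff: "real_coeffs p \<Longrightarrow> real_coeffs q \<Longrightarrow> real_coeffs (p - q)"
  by (simp add: real_coeffs_def)

lemma real_coeffs_mult: "real_coeffs p \<Longrightarrow> real_coeffs q \<Longrightarrow> real_coeffs (p * q)"
  by (auto simp: real_coeffs_def coeff_mult intro!: sum_in_Reals)

lemma real_coeffs_smult: "c \<in> \<real> \<Longrightarrow> real_coeffs p \<Longrightarrow> real_coeffs (smult c p)"
  by (simp add: real_coeffs_def)

lemma real_coeffs_of_int_poly: "real_coeffs (map_poly of_int p)"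
  by (simp add: real_coeffs_def coeff_map_poly)

text \<open>Comparing degrees makes such a \<open>u\<close> constant, and for a real constant
  \<open>r\<close> the number \<open>r\<^sup>2 * 3 + 1\<close> is positive.\<close>

lemma square_plus_one_nonzero:
  assumes "real_coeffs u"
  shows "3 * u\<^sup>2 + 1 \<noteq> 0"
proof
  assume "3 * u\<^sup>2 + 1 = 0"
  then have eq: "u\<^sup>2 * 3 = - 1"
    by algebra
  then have "u \<noteq> 0"
    by auto
  then have "2 * degree u = degree (u\<^sup>2 * 3)"
    by (simp add: degree_mult_eq degree_power_eq)
  then have "degree u = 0"
    unfolding eq by simp
  then obtain c where c: "u = [:c:]"
    by (rule degree_eq_zeroE)
  have "c \<in> \<real>"
    using assms unfolding real_coeffs_def c by (metis coeff_pCons_0)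
  then obtain r where r: "c = of_real r"
    by (rule Reals_cases)
  have "poly (u\<^sup>2 * 3) 0 = - 1"
    unfolding eq by simp
  then have "of_real (r\<^sup>2 * 3 + 1) = (0 :: complex)"
    by (simp add: c r)
  then have "r\<^sup>2 * 3 + 1 = 0"
    by (simp only: of_real_eq_0_iff)
  then show False
    using zero_le_power2[of r] by linarith
qed

text \<open>
  On a curve with non-constant \<open>z\<close>, the equation is quadratic in \<open>y\<close> and in \<open>u\<close>, and replacing
  the one of higher degree by the other root lowers its degree, down to \<open>(\<plusminus>1, 0)\<close>. Undoing
  the replacement of \<open>u\<close> introduces a factor \<open>3\<close> in the denominators at points where \<open>z\<close> is an
  integer prime to \<open>3\<close>. The real coefficients exclude \<open>y = 0\<close>, \<open>u\<^sup>2 = - 1 / 3\<close>.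
\<close>

lemma three_adic_values_on_curve:
  fixes y u z :: "complex poly"
  assumes "0 < degree z" "poly z s = of_int z0" "\<not> 3 dvd z0" and rz: "real_coeffs z"
    and "real_coeffs y" "real_coeffs u" "y\<^sup>2 - 2 * z * u * y - 3 * u\<^sup>2 = 1"
  shows "u = 0
    \<or> degree u < degree y \<and> (\<exists>k p q. 0 < k \<and> \<not> 3 dvd p \<and> \<not> 3 dvd q
        \<and> 3 ^ k * poly u s = of_int p \<and> 3 ^ k * poly y s = of_int q)
    \<or> degree y < degree u \<and> (\<exists>k p q. 0 < k \<and> \<not> 3 dvd p
        \<and> 3 ^ k * poly u s = of_int p \<and> 3 ^ k * poly y s = 3 * of_int q)"
  using assms(5-7)
proof (induction "degree y + degree u" arbitrary: y u rule: less_induct)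
  case less
  note eq = less.prems(3)
  have not_dvd: "\<not> 3 dvd z0 * i" if "\<not> 3 dvd i" for i
    using that assms(3) by (simp add: prime_dvd_mult_iff)
  have "y \<noteq> 0"
  proof
    assume "y = 0"
    then have "3 * u\<^sup>2 + 1 = 0"
      using eq by algebra
    then show False
      using square_plus_one_nonzero less.prems by blast
  qed
  show ?case
  proof (cases "u = 0")
    case False
    have "z \<noteq> 0"
      using assms(1) by auto
    have deg_sum: "degree (c * p\<^sup>2 + d) \<le> 2 * degree p" if "degree c = 0" "degree d = 0"
      for c d p :: "complex poly"
      using that degree_mult_le[of c "p\<^sup>2"] degree_power_le[of p 2]
      by (intro degree_add_le) auto
    have "2 * (z * u * y) = (1 * y\<^sup>2 + 0) - (3 * u\<^sup>2 + 1)"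
      using eq by algebra
    moreover have "degree ((1 * y\<^sup>2 + 0) - (3 * u\<^sup>2 + 1)) \<le> max (2 * degree y) (2 * degree u)"
      using deg_sum[of 1 0 y] deg_sum[of 3 1 u]
      by (intro order_trans[OF degree_diff_le_max] max.mono) simp_all
    ultimately have "degree (2 * (z * u * y)) \<le> max (2 * degree y) (2 * degree u)"
      by simp
    moreover have "degree (2 * (z * u * y)) = degree z + degree u + degree y"
      using \<open>z \<noteq> 0\<close> \<open>y \<noteq> 0\<close> False by (simp add: degree_mult_eq)
    \<comment> \<open>Equal degrees would give
      \<open>degree z + 2 * degree u \<le> 2 * degree u\<close>, although \<open>z\<close> is not
      constant.\<close>
    ultimately have "degree u < degree y \<or> degree y < degree u"
      using assms(1) by linarith
    then show ?thesis
    proof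
      assume less_deg: "degree u < degree y"
      \<comment> \<open>The other root of the quadratic in \<open>y\<close>: by Vieta the roots have
        sum \<open>2 * z * u\<close> and product \<open>- (3 * u\<^sup>2 + 1)\<close>.\<close>
      define y' where "y' = smult 2 (z * u) - y"
      have y': "y' = 2 * z * u - y"
        by (simp add: y'_def numeral_poly)
      have prod: "y * y' = - (3 * u\<^sup>2 + 1)"
        using eq unfolding y' by algebra
      have "y' \<noteq> 0"
      proof
        assume "y' = 0"
        then have "3 * u\<^sup>2 + 1 = 0"
          using prod by algebra
        then show False
          using square_plus_one_nonzero less.prems by blast
      qed
      have "degree y + degree y' = degree (3 * u\<^sup>2 + 1)"
        unfolding degree_mult_eq[OF \<open>y \<noteq> 0\<close> \<open>y' \<noteq> 0\<close>, symmetric] prod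
        by (rule degree_minus)
      then have "degree y' < degree u"
        using less_deg deg_sum[of 3 1 u] by simp
      moreover have "real_coeffs y'"
        unfolding y'_def using less.prems rz
        by (intro real_coeffs_diff real_coeffs_smult real_coeffs_mult) auto
      moreover have "y'\<^sup>2 - 2 * z * u * y' - 3 * u\<^sup>2 = 1"
        using eq unfolding y' by algebra
      \<comment> \<open>As \<open>degree y' < degree u\<close> and \<open>u \<noteq> 0\<close>, the
        third alternative applies to \<open>y'\<close> and \<open>u\<close>. There the numerator of
        \<open>y'\<close> is divisible by \<open>3\<close>, so that of \<open>y\<close> is
        \<open>2 * z0 * p\<close> modulo \<open>3\<close>.\<close>
      ultimately obtain k p q where kpq: "0 < k" "\<not> 3 dvd p"
          "3 ^ k * poly u s = of_int p" "3 ^ k * poly y' s = 3 * of_int q"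
        using less.hyps[of y' u] less_deg less.prems False by fastforce
      have "3 ^ k * poly y s = 2 * poly z s * (3 ^ k * poly u s) - 3 ^ k * poly y' s"
        by (simp add: y' algebra_simps)
      then have "3 ^ k * poly y s = of_int (2 * z0 * p - 3 * q)"
        by (simp add: kpq assms(2))
      moreover have "\<not> 3 dvd 2 * z0 * p - 3 * q"
        using not_dvd[OF kpq(2)] unfolding mult.assoc by presburger
      ultimately show ?thesis
        using kpq less_deg by blast
    next
      assume less_deg: "degree y < degree u"
      \<comment> \<open>The other root of the quadratic in \<open>u\<close>: the sum is
        \<open>- (2 / 3) * z * y\<close>, the product \<open>(1 - y\<^sup>2) / 3\<close>. The
        product vanishes exactly if \<open>y = \<plusminus>1\<close>, where the descent
        ends.\<close>
      define u' where "u' = smult (- (2 / 3)) (z * y) - u"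
      have three_u': "3 * u' = - 2 * z * y - 3 * u"
        by (simp add: u'_def algebra_simps numeral_poly)
      have prod: "3 * u * u' = - 1 * y\<^sup>2 + 1"
        using eq three_u' by algebra
      have val: "3 * poly u s = - 2 * of_int z0 * poly y s - 3 * poly u' s"
        using arg_cong[OF three_u', of "\<lambda>p. poly p s"] assms(2) by (simp add: algebra_simps)
      show ?thesis
      proof (cases "u' = 0")
        case True
        then have "y\<^sup>2 = 1"
          using prod by simp
        then obtain e :: int where e: "e = 1 \<or> e = - 1" "poly y s = of_int e"
          by (metis of_int_1 of_int_minus poly_1 poly_minus power2_eq_1_iff)
        have "3 ^ 1 * poly u s = of_int (- 2 * z0 * e)" "3 ^ 1 * poly y s = 3 * of_int e"
          using val True e(2) by simp_all
        moreover have "\<not> 3 dvd - 2 * z0 * e"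
          using assms(3) e(1) by (elim disjE; simp; presburger)
        ultimately show ?thesis
          using less_deg zero_less_one by blast
      next
        case u'0: False
        have "degree (3 * u * u') = degree u + degree u'"
          using u'0 False by (simp add: degree_mult_eq)
        then have "degree u' < degree y"
          using less_deg deg_sum[of "- 1" 1 y] prod by simp
        moreover have "real_coeffs u'"
          unfolding u'_def using less.prems rz
          by (intro real_coeffs_diff real_coeffs_smult real_coeffs_mult) auto
        moreover have "y\<^sup>2 - 2 * z * u' * y - 3 * u'\<^sup>2 = 1"
          using three_u' prod by algebra
        \<comment> \<open>Now the second alternative applies. Since the numerator \<open>q\<close>
          of \<open>y\<close> is prime to \<open>3\<close>, the division by \<open>3\<close> in the
          sum of the roots gives \<open>u\<close> one more power of \<open>3\<close> in the
          denominator.\<close>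
        ultimately obtain k p q where kpq: "0 < k" "\<not> 3 dvd q"
            "3 ^ k * poly u' s = of_int p" "3 ^ k * poly y s = of_int q"
          using less.hyps[of y u'] less_deg less.prems u'0 by fastforce
        have "3 ^ Suc k * poly u s = 3 ^ k * (3 * poly u s)"
          by simp
        also have "\<dots> = - 2 * of_int z0 * (3 ^ k * poly y s) - 3 * (3 ^ k * poly u' s)"
          unfolding val by (simp add: algebra_simps)
        finally have "3 ^ Suc k * poly u s = of_int (- 2 * z0 * q - 3 * p)"
          by (simp add: kpq)
        moreover have "3 ^ Suc k * poly y s = 3 * of_int q"
          using kpq by simp
        moreover have "\<not> 3 dvd - 2 * z0 * q - 3 * p"
          using not_dvd[OF kpq(2)] unfolding mult.assoc by presburger
        ultimately show ?thesis
          using less_deg zero_less_Suc by blast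
      qed
    qed
  qed simp
qed

text \<open>With \<open>w * w = d\<close> the left side factors into \<open>x - w u\<close> and
  \<open>x + w u\<close>. These are units, hence constants, and \<open>x\<close> and
  \<open>u\<close> are combinations of them. This disposes of curves in a plane of constant
  \<open>z\<close>.\<close>

lemma degree_eq_0_of_pell_const:
  fixes x u :: "complex poly"
  assumes "x\<^sup>2 - [:d:] * u\<^sup>2 = 1" "d \<noteq> 0"
  shows "degree u = 0" "degree x = 0"
proof -
  define w where "w = csqrt d"
  have "w * w = d"
    unfolding w_def by (metis power2_csqrt power2_eq_square)
  then have w: "[:w:] * [:w:] = [:d:]" "w \<noteq> 0"
    using assms(2) by auto
  have unit: "(x - [:w:] * u) * (x + [:w:] * u) = 1"
    using assms(1) w(1) by algebra
  then have nz: "x - [:w:] * u \<noteq> 0" "x + [:w:] * u \<noteq> 0"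
    by auto
  then have "degree (x - [:w:] * u) + degree (x + [:w:] * u) = 0"
    using unit degree_mult_eq[OF nz] by simp
  then have deg: "degree (x - [:w:] * u) = 0" "degree (x + [:w:] * u) = 0"
    by auto
  have "smult (2 * w) u = (x + [:w:] * u) - (x - [:w:] * u)"
    "smult 2 x = (x + [:w:] * u) + (x - [:w:] * u)"
    by (simp_all add: poly_eq_iff numeral_poly)
  then have "degree (smult (2 * w) u) = 0" "degree (smult 2 x) = 0"
    using deg degree_diff_le[of "x + [:w:] * u" 0 "x - [:w:] * u"]
      degree_add_le[of "x + [:w:] * u" 0 "x - [:w:] * u"] by simp_all
  then show "degree u = 0" "degree x = 0"
    using w(2) by simp_all
qed

text \<open>If \<open>z\<close> is constant on a curve, Pell's equation with constant
  \<open>d\<close> makes the whole curve constant. If \<open>z\<close> varies, the value of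
  \<open>u\<close> at the point has a power of \<open>3\<close> in its denominator and cannot be the
  integer \<open>u0\<close>. The condition \<open>u0 \<noteq> 0\<close> excludes the lines
  \<open>y = \<plusminus>1\<close>, \<open>u = 0\<close>.\<close>

lemma U_circI:
  assumes "(y0, u0, z0) \<in> U_points" "u0 \<noteq> 0" "\<not> 3 dvd z0"
  shows "(y0, u0, z0) \<in> U_circ"
proof -
  have False if C: "A1_curve C" "(of_int y0, of_int u0, of_int z0) \<in> C" for C
  proof -
    obtain y u z :: "int poly" where nonconst: "\<not> (degree y = 0 \<and> degree u = 0 \<and> degree z = 0)"
      and range: "C = range (\<lambda>s. (poly (map_poly of_int y) s, poly (map_poly of_int u) s,
                     poly (map_poly of_int z) s))" and sub: "C \<subseteq> U_points"
      using C(1) unfolding A1_curve_def by blast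
    define Y U Z :: "complex poly" where YUZ: "Y = map_poly of_int y" "U = map_poly of_int u"
      "Z = map_poly of_int z"
    have real: "real_coeffs Y" "real_coeffs U" "real_coeffs Z"
      by (simp_all add: YUZ real_coeffs_of_int_poly)
    have degs: "degree Y = degree y" "degree U = degree u" "degree Z = degree z"
      by (simp_all add: YUZ degree_map_poly)
    obtain s where s: "poly Y s = of_int y0" "poly U s = of_int u0" "poly Z s = of_int z0"
      using C(2) unfolding range YUZ by auto
    have "poly (Y\<^sup>2 - 2 * Z * U * Y - 3 * U\<^sup>2) t = poly 1 t" for t
    proof -
      have "(poly Y t, poly U t, poly Z t) \<in> U_points"
        using sub unfolding range YUZ by blast
      then show ?thesis
        by (simp add: U_points_def algebra_simps)
    qed
    then have eq: "Y\<^sup>2 - 2 * Z * U * Y - 3 * U\<^sup>2 = 1"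
      by (intro poly_ext) blast
    show False
    proof (cases "degree Z = 0")
      case True
      then have Z: "Z = [:of_int z0:]"
        using s(3) by (metis degree_eq_zeroE poly_const_conv)
      have "(Y - Z * U)\<^sup>2 - [:of_int (z0\<^sup>2 + 3):] * U\<^sup>2 = 1"
      proof -
        have "[:of_int (z0\<^sup>2 + 3):] = Z\<^sup>2 + 3"
          by (simp add: Z power2_eq_square numeral_poly)
        then show ?thesis
          using eq by algebra
      qed
      moreover have "(of_int (z0\<^sup>2 + 3) :: complex) \<noteq> 0"
        using zero_le_power2[of z0] by (simp only: of_int_eq_0_iff)
      ultimately have "degree U = 0" "degree (Y - Z * U) = 0"
        using degree_eq_0_of_pell_const by blast+
      moreover have "Y = (Y - Z * U) + Z * U"
        by simp
      ultimately have "degree Y = 0"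
        using True degree_add_le[of "Y - Z * U" 0 "Z * U"] degree_mult_le[of Z U] by simp
      then show False
        using nonconst degs True \<open>degree U = 0\<close> by simp
    next
      case False
      have "U \<noteq> 0"
        using s(2) assms(2) by auto
      then obtain k p where k: "0 < k" "\<not> 3 dvd p" "3 ^ k * poly U s = of_int p"
        using three_adic_values_on_curve[OF _ s(3) assms(3) real(3,1,2) eq] False by blast
      then have "(of_int (3 ^ k * u0) :: complex) = of_int p"
        by (simp add: s)
      then have "3 ^ k * u0 = p"
        by (simp only: of_int_eq_iff)
      then show False
        using k by (metis dvd_mult2 dvd_power)
    qed
  qed
  then show ?thesis
    using assms(1) unfolding U_circ_def by blast
qed

subsection \<open>Periods of indefinite forms\<close>

lemma equiv_properly_equivalent: "equiv UNIV properly_equivalent"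
proof (rule equivI)
  show "properly_equivalent \<subseteq> UNIV \<times> UNIV"
    by simp
  show "refl properly_equivalent"
  proof (rule refl_onI)
    fix f :: bqf
    have "(1::int) * 1 - 0 * 0 = 1 \<and>
        (\<forall>x y. form_value f x y = form_value f (1 * x + 0 * y) (0 * x + 1 * y))"
      by simp
    then show "(f, f) \<in> properly_equivalent"
      unfolding properly_equivalent_def by blast
  qed
  show "sym properly_equivalent"
  proof (rule symI)
    fix f g :: bqf
    assume "(f, g) \<in> properly_equivalent"
    then obtain p q r s :: int where det: "p * s - q * r = 1"
      and v: "\<And>x y. form_value g x y = form_value f (p * x + q * y) (r * x + s * y)"
      unfolding properly_equivalent_def by blast
    have "form_value f x y = form_value g (s * x + (- q) * y) ((- r) * x + p * y)" for x y
    proof -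
      have "p * (s * x + (- q) * y) + q * ((- r) * x + p * y) = (p * s - q * r) * x"
        "r * (s * x + (- q) * y) + s * ((- r) * x + p * y) = (p * s - q * r) * y"
        by (simp_all add: algebra_simps)
      then show ?thesis
        using det v by simp
    qed
    moreover have "s * p - (- q) * (- r) = 1"
      using det by (simp add: algebra_simps)
    ultimately show "(g, f) \<in> properly_equivalent"
      unfolding properly_equivalent_def by blast
  qed
  show "trans properly_equivalent"
  proof (rule transI)
    fix f g h :: bqf
    assume "(f, g) \<in> properly_equivalent" "(g, h) \<in> properly_equivalent"
    then obtain p q r s p' q' r' s' :: int where det: "p * s - q * r = 1" "p' * s' - q' * r' = 1"
      and v: "\<And>x y. form_value g x y = form_value f (p * x + q * y) (r * x + s * y)"
        "\<And>x y. form_value h x y = form_value g (p' * x + q' * y) (r' * x + s' * y)"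
      unfolding properly_equivalent_def by blast
    have "form_value h x y = form_value f ((p * p' + q * r') * x + (p * q' + q * s') * y)
        ((r * p' + s * r') * x + (r * q' + s * s') * y)" for x y
      unfolding v by (simp add: algebra_simps)
    moreover have "(p * p' + q * r') * (r * q' + s * s') - (p * q' + q * s') * (r * p' + s * r')
        = (p * s - q * r) * (p' * s' - q' * r')"
      by (simp add: algebra_simps)
    then have "(p * p' + q * r') * (r * q' + s * s') - (p * q' + q * s') * (r * p' + s * r') = 1"
      using det by simp
    ultimately show "(f, h) \<in> properly_equivalent"
      unfolding properly_equivalent_def by blast
  qed
qed

section \<open>Unimodular substitutions and reduction to the river\<close>

fun shift_left :: "int \<Rightarrow> bqf \<Rightarrow> bqf" where
  "shift_left k (a, b, c) = (a, b + k * a, a * k\<^sup>2 + 2 * k * b + c)"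

fun shift_right :: "int \<Rightarrow> bqf \<Rightarrow> bqf" where
  "shift_right k (a, b, c) = (a + 2 * k * b + c * k\<^sup>2, b + k * c, c)"

fun swap_form :: "bqf \<Rightarrow> bqf" where
  "swap_form (a, b, c) = (c, - b, a)"

lemma form_value_shift_left: "form_value (shift_left k f) x y = form_value f (x + k * y) y"
  by (cases f) (simp add: algebra_simps power2_eq_square)

lemma form_value_shift_right: "form_value (shift_right k f) x y = form_value f x (k * x + y)"
  by (cases f) (simp add: algebra_simps power2_eq_square)

lemma form_value_swap: "form_value (swap_form f) x y = form_value f (- y) x"
  by (cases f) (simp add: algebra_simps power2_eq_square)

lemma form_det_moves [simp]:
  "form_det (shift_left k f) = form_det f"
  "form_det (shift_right k f) = form_det f"
  "form_det (swap_form f) = form_det f"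
  by (cases f; simp add: algebra_simps power2_eq_square)+

text \<open>A Bezout relation is linear in the coefficients of the form, so it passes through
  substitutions directly; it also produces the integer \<open>u\<close> in
  \<open>automorph_gives_pell\<close>.\<close>

lemma properly_primitive_iff_bezout:
  "properly_primitive (a, b, c) \<longleftrightarrow> (\<exists>i j k. i * a + j * (2 * b) + k * c = 1)"
proof
  assume "properly_primitive (a, b, c)"
  then have g: "gcd a (gcd (2 * b) c) = 1"
    by simp
  obtain j k where jk: "j * (2 * b) + k * c = gcd (2 * b) c"
    by (metis bezout_int)
  obtain i l where "i * a + l * gcd (2 * b) c = gcd a (gcd (2 * b) c)"
    by (metis bezout_int)
  then have "i * a + (l * j) * (2 * b) + (l * k) * c = 1"
    using g jk[symmetric] by (simp add: algebra_simps)
  then show "\<exists>i j k. i * a + j * (2 * b) + k * c = 1"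
    by blast
next
  assume "\<exists>i j k. i * a + j * (2 * b) + k * c = 1"
  then obtain i j k where "i * a + j * (2 * b) + k * c = 1"
    by blast
  moreover have "gcd a (gcd (2 * b) c) dvd i * a + j * (2 * b) + k * c"
    by (meson dvd_add dvd_mult dvd_trans gcd_dvd1 gcd_dvd2)
  ultimately show "properly_primitive (a, b, c)"
    by (simp only: properly_primitive.simps) simp
qed

lemma properly_primitive_moves:
  assumes "properly_primitive f"
  shows "properly_primitive (shift_left m f)" "properly_primitive (shift_right m f)"
    "properly_primitive (swap_form f)"
proof -
  obtain a b c where f: "f = (a, b, c)"
    by (cases f)
  obtain i j k where ijk: "i * a + j * (2 * b) + k * c = 1"
    using assms unfolding f properly_primitive_iff_bezout by blast
  \<comment> \<open>The new Bezout coefficients result from expressing \<open>a\<close>,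
    \<open>b\<close>, \<open>c\<close> through the coefficients of the shifted form.\<close>
  have "(i - 2 * j * m + k * m\<^sup>2) * a + (j - k * m) * (2 * (b + m * a))
      + k * (a * m\<^sup>2 + 2 * m * b + c) = 1"
    using ijk by (simp add: algebra_simps power2_eq_square)
  then show "properly_primitive (shift_left m f)"
    unfolding f shift_left.simps properly_primitive_iff_bezout by blast
  have "i * (a + 2 * m * b + c * m\<^sup>2) + (j - i * m) * (2 * (b + m * c))
      + (k - 2 * j * m + i * m\<^sup>2) * c = 1"
    using ijk by (simp add: algebra_simps power2_eq_square)
  then show "properly_primitive (shift_right m f)"
    unfolding f shift_right.simps properly_primitive_iff_bezout by blast
  have "k * c + (- j) * (2 * (- b)) + i * a = 1"
    using ijk by (simp add: algebra_simps)
  then show "properly_primitive (swap_form f)"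
    unfolding f swap_form.simps properly_primitive_iff_bezout by blast
qed

lemma properly_equivalent_moves:
  "(f, shift_left k f) \<in> properly_equivalent" "(f, shift_right k f) \<in> properly_equivalent"
  "(f, swap_form f) \<in> properly_equivalent"
proof -
  have "(1::int) * 1 - k * 0 = 1 \<and>
    (\<forall>x y. form_value (shift_left k f) x y = form_value f (1 * x + k * y) (0 * x + 1 * y))"
    by (simp add: form_value_shift_left)
  then show "(f, shift_left k f) \<in> properly_equivalent"
    unfolding properly_equivalent_def by blast
  have "(1::int) * 1 - 0 * k = 1 \<and>
    (\<forall>x y. form_value (shift_right k f) x y = form_value f (1 * x + 0 * y) (k * x + 1 * y))"
    by (simp add: form_value_shift_right)
  then show "(f, shift_right k f) \<in> properly_equivalent"
    unfolding properly_equivalent_def by blast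
  have "(0::int) * 0 - (- 1) * 1 = 1 \<and>
    (\<forall>x y. form_value (swap_form f) x y = form_value f (0 * x + (- 1) * y) (1 * x + 0 * y))"
    by (simp add: form_value_swap)
  then show "(f, swap_form f) \<in> properly_equivalent"
    unfolding properly_equivalent_def by blast
qed

text \<open>
  In Conway's terminology these are the forms on the river: the edges of the topograph that
  separate positive from negative values.
\<close>

definition river :: "int \<Rightarrow> bqf set" where
  "river d = {(a, b, c). 0 < a \<and> c < 0 \<and> b\<^sup>2 - a * c = d}"

lemma river_iff: "f \<in> river d \<longleftrightarrow> 0 < fst f \<and> snd (snd f) < 0 \<and> form_det f = d"
  by (cases f) (auto simp: river_def)

text \<open>
  If the outer coefficients have the same sign, then \<open>b\<^sup>2 > a c\<close> makes one of them smaller than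
  \<open>b\<close> in absolute value, so a shift by it decreases the middle coefficient.
\<close>

lemma properly_equivalent_river:
  assumes "0 < d" "\<And>r. r\<^sup>2 \<noteq> d" "form_det f = d" "properly_primitive f"
  shows "\<exists>g \<in> river d. properly_primitive g \<and> (f, g) \<in> properly_equivalent"
  using assms(3,4)
proof (induction "nat \<bar>fst (snd f)\<bar>" arbitrary: f rule: less_induct)
  case less
  obtain a b c where f: "f = (a, b, c)"
    by (cases f)
  have det: "b\<^sup>2 - a * c = d"
    using less.prems f by simp
  have "a \<noteq> 0" "c \<noteq> 0"
    using assms(2)[of b] det by auto
  have smaller: "\<exists>g \<in> river d. properly_primitive g \<and> (f, g) \<in> properly_equivalent"
    if "\<bar>fst (snd f')\<bar> < \<bar>b\<bar>" "form_det f' = d" "properly_primitive f'"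
      "(f, f') \<in> properly_equivalent" for f'
  proof -
    have "\<exists>g \<in> river d. properly_primitive g \<and> (f', g) \<in> properly_equivalent"
      using that less.hyps[of f'] f by auto
    then show ?thesis
      using that(4) equiv_properly_equivalent by (meson equivE transD)
  qed
  have shrink: "\<exists>k. \<bar>b + k * e\<bar> < \<bar>b\<bar>" if "e \<noteq> 0" "\<bar>e\<bar> < \<bar>b\<bar>" for e :: int
  proof -
    have "\<bar>b + 1 * e\<bar> < \<bar>b\<bar> \<or> \<bar>b + (- 1) * e\<bar> < \<bar>b\<bar>"
      using that by linarith
    then show ?thesis
      by blast
  qed
  consider "0 < a" "c < 0" | "a < 0" "0 < c" | "0 < a * c"
    using \<open>a \<noteq> 0\<close> \<open>c \<noteq> 0\<close> by (metis linorder_neqE_linordered_idom mult_neg_neg mult_pos_pos)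
  then show ?case
  proof cases
    case 1
    then have "f \<in> river d"
      using f det by (simp add: river_def)
    moreover have "(f, f) \<in> properly_equivalent"
      using equiv_properly_equivalent by (meson UNIV_I equivE refl_onD)
    ultimately show ?thesis
      using less.prems by blast
  next
    case 2
    then have "swap_form f \<in> river d"
      using f det by (simp add: river_def algebra_simps)
    then show ?thesis
      using less.prems properly_primitive_moves(3) properly_equivalent_moves(3) by blast
  next
    case 3
    have "\<bar>a\<bar> * \<bar>c\<bar> < \<bar>b\<bar> * \<bar>b\<bar>"
      using 3 det assms(1) by (simp add: abs_mult[symmetric] power2_eq_square)
    then have "\<bar>a\<bar> < \<bar>b\<bar> \<or> \<bar>c\<bar> < \<bar>b\<bar>"
      by (meson abs_ge_zero linorder_not_less mult_mono)
    then show ?thesis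
    proof
      assume "\<bar>a\<bar> < \<bar>b\<bar>"
      then obtain k where "\<bar>b + k * a\<bar> < \<bar>b\<bar>"
        using shrink \<open>a \<noteq> 0\<close> by blast
      then have "\<bar>fst (snd (shift_left k f))\<bar> < \<bar>b\<bar>"
        by (simp add: f)
      then show ?thesis
        by (rule smaller) (simp_all only: form_det_moves less.prems properly_primitive_moves
            properly_equivalent_moves)
    next
      assume "\<bar>c\<bar> < \<bar>b\<bar>"
      then obtain k where "\<bar>b + k * c\<bar> < \<bar>b\<bar>"
        using shrink \<open>c \<noteq> 0\<close> by blast
      then have "\<bar>fst (snd (shift_right k f))\<bar> < \<bar>b\<bar>"
        by (simp add: f)
      then show ?thesis
        by (rule smaller) (simp_all only: form_det_moves less.prems properly_primitive_moves
            properly_equivalent_moves)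
    qed
  qed
qed

section \<open>Walking along the river\<close>

text \<open>\<open>form_value f 1 1\<close> is the value on the next region of the topograph. It
  replaces the outer coefficient of its own sign, so one region stays on each bank.\<close>

definition river_step :: "bqf \<Rightarrow> bqf" where
  "river_step f = (if form_value f 1 1 < 0 then shift_left 1 f else shift_right 1 f)"

lemma form_value_nonzero:
  assumes "\<And>r. r\<^sup>2 \<noteq> form_det f"
  shows "form_value f 1 1 \<noteq> 0"
proof
  obtain a b c where f: "f = (a, b, c)"
    by (cases f)
  assume "form_value f 1 1 = 0"
  then have c: "c = - a - 2 * b"
    using f by simp
  have "(a + b)\<^sup>2 = b\<^sup>2 - a * c"
    unfolding c by (simp add: algebra_simps power2_eq_square)
  then have "(a + b)\<^sup>2 = form_det f"
    by (simp add: f)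
  then show False
    using assms by blast
qed

lemma river_step_in_river:
  assumes "\<And>r. r\<^sup>2 \<noteq> d" "f \<in> river d"
  shows "river_step f \<in> river d"
proof -
  have "form_value f 1 1 \<noteq> 0"
    using assms form_value_nonzero[of f] by (simp add: river_iff)
  then show ?thesis
    using assms(2)
    by (cases f) (auto simp: river_def river_step_def algebra_simps power2_eq_square)
qed

text \<open>
  The sign of \<open>a - 2 b + c\<close> in \<open>river_step f\<close> tells which of the two shifts was applied.
\<close>

lemma inj_on_river_step:
  assumes "\<And>r. r\<^sup>2 \<noteq> d"
  shows "inj_on river_step (river d)"
proof (rule inj_onI)
  fix f g
  assume fg: "f \<in> river d" "g \<in> river d" "river_step f = river_step g"
  then have "form_value f 1 1 \<noteq> 0" "form_value g 1 1 \<noteq> 0"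
    using assms form_value_nonzero by (simp_all add: river_iff)
  with fg show "f = g"
    by (cases f; cases g) (auto simp: river_def river_step_def split: if_splits)
qed

text \<open>A step multiplies the matrix on the right by \<open>(1, 1; 0, 1)\<close> or
  \<open>(1, 0; 1, 1)\<close>. Entries stay nonnegative and at most double, and an off-diagonal
  entry becomes positive because \<open>p\<close> and \<open>s\<close> never vanish.\<close>

lemma river_step_iterate_transform:
  "\<exists>p q r s. 0 \<le> p \<and> 0 \<le> q \<and> 0 \<le> r \<and> 0 \<le> s
    \<and> p \<le> 2 ^ n \<and> q \<le> 2 ^ n \<and> r \<le> 2 ^ n \<and> s \<le> 2 ^ n \<and> p * s - q * r = 1
    \<and> (0 < n \<longrightarrow> q \<noteq> 0 \<or> r \<noteq> 0)
    \<and> (\<forall>x y. form_value ((river_step ^^ n) f) x y = form_value f (p * x + q * y) (r * x + s * y))"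
proof (induction n)
  case 0
  show ?case
    by (rule exI[of _ 1], rule exI[of _ 0], rule exI[of _ 0], rule exI[of _ 1]) simp
next
  case (Suc n)
  then obtain p q r s :: int where nonneg: "0 \<le> p" "0 \<le> q" "0 \<le> r" "0 \<le> s"
    and le: "p \<le> 2 ^ n" "q \<le> 2 ^ n" "r \<le> 2 ^ n" "s \<le> 2 ^ n" and det: "p * s - q * r = 1"
    and v: "\<And>x y. form_value ((river_step ^^ n) f) x y
      = form_value f (p * x + q * y) (r * x + s * y)"
    by blast
  have "p \<noteq> 0" "s \<noteq> 0"
    using det nonneg by (smt (verit) mult_eq_0_iff mult_nonneg_nonneg)+
  let ?f = "(river_step ^^ n) f"
  show ?case
  proof (cases "form_value ?f 1 1 < 0")
    case True
    then have "form_value ((river_step ^^ Suc n) f) x y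
        = form_value f (p * x + (p + q) * y) (r * x + (r + s) * y)" for x y
      by (simp add: river_step_def form_value_shift_left v algebra_simps)
    moreover have "p * (r + s) - (p + q) * r = 1"
      using det by (simp add: algebra_simps)
    ultimately show ?thesis
      using nonneg le \<open>p \<noteq> 0\<close>
      by (intro exI[of _ p] exI[of _ "p + q"] exI[of _ r] exI[of _ "r + s"]) auto
  next
    case False
    then have "form_value ((river_step ^^ Suc n) f) x y
        = form_value f ((p + q) * x + q * y) ((r + s) * x + s * y)" for x y
      by (simp add: river_step_def form_value_shift_right v algebra_simps)
    moreover have "(p + q) * s - q * (r + s) = 1"
      using det by (simp add: algebra_simps)
    ultimately show ?thesis
      using nonneg le \<open>s \<noteq> 0\<close>
      by (intro exI[of _ "p + q"] exI[of _ q] exI[of _ "r + s"] exI[of _ s]) auto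
  qed
qed

section \<open>Automorphs and Pell's equation\<close>

text \<open>The classical shape of an automorph: \<open>p = x - b u\<close>,
  \<open>q = - c u\<close>, \<open>r = a u\<close>, \<open>s = x + b u\<close>. Its determinant
  being \<open>1\<close> is Pell's equation.\<close>

lemma automorph_gives_pell:
  assumes "properly_primitive f" and det: "p * s - q * r = 1"
    and v: "\<And>x y. form_value f x y = form_value f (p * x + q * y) (r * x + s * y)"
  shows "\<exists>x u. 2 * x = p + s \<and> x\<^sup>2 - form_det f * u\<^sup>2 = 1 \<and> (u = 0 \<longrightarrow> q = 0 \<and> r = 0)"
proof -
  obtain a b c where f: "f = (a, b, c)"
    by (cases f)
  have e1: "a = a * p\<^sup>2 + 2 * b * p * r + c * r\<^sup>2"
    using v[of 1 0] by (simp add: f)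
  have e3: "c = a * q\<^sup>2 + 2 * b * q * s + c * s\<^sup>2"
    using v[of 0 1] by (simp add: f)
  have "a + 2 * b + c = a * (p + q)\<^sup>2 + 2 * b * (p + q) * (r + s) + c * (r + s)\<^sup>2"
    using v[of 1 1] by (simp add: f)
  then have "2 * b = 2 * (a * p * q + b * (p * s + q * r) + c * r * s)"
    using e1 e3 by (simp add: algebra_simps power2_eq_square)
  then have e2: "b = a * p * q + b * (p * s + q * r) + c * r * s"
    by simp
  \<comment> \<open>The three relations say that \<open>(r, s - p, - q)\<close> is proportional to
    \<open>(a, 2 * b, c)\<close>.\<close>
  have r1: "a * (s - p) = 2 * b * r"
    using e1 e2 det by algebra
  have r2: "- (a * q) = c * r"
    using e1 e2 det by algebra
  have r3: "c * (s - p) = - (2 * b * q)"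
    using e2 e3 det by algebra
  obtain i j k where ijk: "i * a + j * (2 * b) + k * c = 1"
    using assms(1) unfolding f properly_primitive_iff_bezout by blast
  \<comment> \<open>The Bezout combination of the first vector gives the factor of proportionality
    as an integer. Using \<open>2 * b\<close> rather than \<open>b\<close> makes
    \<open>s - p\<close> even, hence \<open>x\<close> integral.\<close>
  define u where "u = i * r + j * (s - p) - k * q"
  have "r = u * a"
    using ijk r1 r2 unfolding u_def by algebra
  moreover have "s - p = u * (2 * b)"
    using ijk r1 r3 unfolding u_def by algebra
  moreover have "- q = u * c"
    using ijk r2 r3 unfolding u_def by algebra
  ultimately have rsq: "r = u * a" "s = p + 2 * (u * b)" "q = - (u * c)"
    by algebra+
  have "2 * (p + u * b) = p + s"
    by (simp add: rsq)
  moreover have "(p + u * b)\<^sup>2 - form_det f * u\<^sup>2 = 1"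
    using det by (simp add: f rsq algebra_simps power2_eq_square)
  moreover have "u = 0 \<longrightarrow> q = 0 \<and> r = 0"
    by (simp add: rsq)
  ultimately show ?thesis
    by blast
qed

text \<open>The scale is logarithmic because \<open>n\<close> steps give a matrix with entries at
  most \<open>2 ^ n\<close>, so half its trace is at most \<open>2 ^ n\<close>.\<close>

definition pell_solvable_upto :: "int \<Rightarrow> nat \<Rightarrow> bool" where
  "pell_solvable_upto d n \<longleftrightarrow> (\<exists>x u. 0 < x \<and> x \<le> 2 ^ n \<and> u \<noteq> 0 \<and> x\<^sup>2 - d * u\<^sup>2 = 1)"

lemma pell_solvable_upto_mono: "pell_solvable_upto d m \<Longrightarrow> m \<le> n \<Longrightarrow> pell_solvable_upto d n"
  unfolding pell_solvable_upto_def
  by (meson one_le_numeral order_trans power_increasing)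

lemma abs_le_power2: "\<bar>b\<bar> \<le> b\<^sup>2" for b :: int
proof (cases "b = 0")
  case False
  then have "\<bar>b\<bar> * 1 \<le> \<bar>b\<bar> * \<bar>b\<bar>"
    by (intro mult_left_mono) auto
  then show ?thesis
    by (simp add: power2_eq_square)
qed simp

lemma finite_river: "finite (river d)"
proof (rule finite_subset)
  show "river d \<subseteq> {1..d} \<times> {-d..d} \<times> {-d..-1}"
  proof
    fix f
    assume "f \<in> river d"
    then obtain a b c where f: "f = (a, b, c)" "0 < a" "c < 0" "b\<^sup>2 - a * c = d"
      by (cases f) (auto simp: river_def)
    have "a \<le> a * (- c)" "- c \<le> a * (- c)"
      using f mult_left_mono[of 1 "- c" a] mult_right_mono[of 1 a "- c"] by auto
    then have "a \<le> d" "- c \<le> d"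
      using f(4) zero_le_power2[of b] by linarith+
    moreover have "\<bar>b\<bar> \<le> b\<^sup>2"
      by (rule abs_le_power2)
    moreover have "b\<^sup>2 \<le> d"
      using f mult_pos_neg[of a c] by linarith
    ultimately show "f \<in> {1..d} \<times> {-d..d} \<times> {-d..-1}"
      using f(1-3) by auto
  qed
qed simp

lemma river_step_iterate_in_river:
  assumes "\<And>r. r\<^sup>2 \<noteq> d" "f \<in> river d"
  shows "(river_step ^^ n) f \<in> river d"
  by (induction n) (use assms river_step_in_river in auto)

lemma river_step_no_short_period:
  assumes "\<And>r. r\<^sup>2 \<noteq> d" "f \<in> river d" "properly_primitive f" "\<not> pell_solvable_upto d n"
    and "0 < k" "k \<le> n"
  shows "(river_step ^^ k) f \<noteq> f"
proof
  assume eq: "(river_step ^^ k) f = f"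
  obtain p q r s :: int where nonneg: "0 \<le> p" "0 \<le> q" "0 \<le> r" "0 \<le> s"
    and le: "p \<le> 2 ^ k" "s \<le> 2 ^ k" and det: "p * s - q * r = 1"
    and nontriv: "q \<noteq> 0 \<or> r \<noteq> 0"
    and v: "\<And>x y. form_value f x y = form_value f (p * x + q * y) (r * x + s * y)"
    using river_step_iterate_transform[of k f] \<open>0 < k\<close> unfolding eq by blast
  obtain x u where xu: "2 * x = p + s" "x\<^sup>2 - d * u\<^sup>2 = 1" "u \<noteq> 0"
    using automorph_gives_pell[OF assms(3) det v] nontriv assms(2) unfolding river_iff by blast
  have "p \<noteq> 0"
    using det nonneg by (smt (verit) mult_eq_0_iff mult_nonneg_nonneg)
  then have "0 < x" "x \<le> 2 ^ k"
    using xu(1) nonneg le by linarith+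
  then have "pell_solvable_upto d k"
    unfolding pell_solvable_upto_def using xu by blast
  then show False
    using assms pell_solvable_upto_mono by blast
qed

lemma inj_on_river_step_iterates:
  assumes nonsq: "\<And>r. r\<^sup>2 \<noteq> d" and f: "f \<in> river d" "properly_primitive f"
    and "\<not> pell_solvable_upto d n"
  shows "inj_on (\<lambda>k. (river_step ^^ k) f) {..n}"
proof (rule linorder_inj_onI')
  fix i j
  assume ij: "i \<in> {..n}" "j \<in> {..n}" "i < j"
  \<comment> \<open>The step is injective on the river, so common initial steps cancel and a
    coincidence becomes a period.\<close>
  have inj: "g = h" if "(river_step ^^ m) g = (river_step ^^ m) h" "g \<in> river d" "h \<in> river d"
    for m g h
    using that
  proof (induction m)
    case (Suc m)
    then have "(river_step ^^ m) g = (river_step ^^ m) h"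
      using inj_onD[OF inj_on_river_step[OF nonsq]] river_step_iterate_in_river[OF nonsq] by simp
    then show ?case
      using Suc by blast
  qed simp
  show "(river_step ^^ i) f \<noteq> (river_step ^^ j) f"
  proof
    assume "(river_step ^^ i) f = (river_step ^^ j) f"
    also have "\<dots> = (river_step ^^ i) ((river_step ^^ (j - i)) f)"
      using ij(3) fun_cong[OF funpow_add[of i "j - i" river_step], of f] by simp
    finally have "f = (river_step ^^ (j - i)) f"
      using inj f(1) river_step_iterate_in_river[OF nonsq f(1)] by blast
    moreover have "0 < j - i" "j - i \<le> n"
      using ij by auto
    ultimately show False
      using river_step_no_short_period[OF assms] by metis
  qed
qed

lemma properly_equivalent_river_step_iterate: "(f, (river_step ^^ n) f) \<in> properly_equivalent"
proof -
  obtain p q r s :: int where "p * s - q * r = 1"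
      "\<forall>x y. form_value ((river_step ^^ n) f) x y = form_value f (p * x + q * y) (r * x + s * y)"
    using river_step_iterate_transform[of n f] by blast
  then show ?thesis
    unfolding properly_equivalent_def by blast
qed

text \<open>
  Along the river the step permutes the forms of a class cyclically, and a period of length \<open>k\<close>
  yields a solution of Pell's equation of size at most \<open>2 ^ k\<close>. So every class occupies more
  than \<open>n\<close> edges of the river if there is no small solution.
\<close>

lemma class_number_le_river:
  assumes "0 < d" and nonsq: "\<And>r. r\<^sup>2 \<noteq> d" and "\<not> pell_solvable_upto d n"
  shows "class_number d * (n + 1) \<le> card (river d)"
proof -
  define Q where "Q = {f. form_det f = d \<and> properly_primitive f \<and> indefinite f} // properly_equivalent"
  have trans: "trans properly_equivalent"
    using equiv_properly_equivalent by (simp add: equiv_def)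
  have Q_sub: "Q \<subseteq> UNIV // properly_equivalent"
    unfolding Q_def quotient_def by blast
  have large: "n + 1 \<le> card (X \<inter> river d)" if X: "X \<in> Q" for X
  proof -
    obtain f where f: "X = properly_equivalent `` {f}" "form_det f = d" "properly_primitive f"
      using X unfolding Q_def quotient_def by blast
    obtain g where g: "g \<in> river d" "properly_primitive g" "(f, g) \<in> properly_equivalent"
      using properly_equivalent_river[OF assms(1) nonsq f(2,3)] by blast
    have "(f, (river_step ^^ k) g) \<in> properly_equivalent" for k
      using trans g(3) properly_equivalent_river_step_iterate by (rule transD)
    then have "(\<lambda>k. (river_step ^^ k) g) ` {..n} \<subseteq> X \<inter> river d"
      using river_step_iterate_in_river[OF nonsq g(1)] unfolding f(1) by blast
    then have "card ((\<lambda>k. (river_step ^^ k) g) ` {..n}) \<le> card (X \<inter> river d)"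
      using finite_river by (intro card_mono) auto
    then show ?thesis
      using card_image[OF inj_on_river_step_iterates[OF nonsq g(1,2) assms(3)]] by simp
  qed
  have disj: "(X \<inter> river d) \<inter> (Y \<inter> river d) = {}" if "X \<in> Q" "Y \<in> Q" "X \<noteq> Y" for X Y
    using that Q_sub quotient_disj[OF equiv_properly_equivalent] by blast
  \<comment> \<open>Classes are recovered from their nonempty, disjoint traces on the finite river,
    so there are finitely many; the cardinality of the union below requires this.\<close>
  have "inj_on (\<lambda>X. X \<inter> river d) Q"
  proof (rule inj_onI, rule ccontr)
    fix X Y
    assume XY: "X \<in> Q" "Y \<in> Q" "X \<inter> river d = Y \<inter> river d" "X \<noteq> Y"
    then have "X \<inter> river d = {}"
      using disj by blast
    then show False
      using large[OF XY(1)] by simp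
  qed
  moreover have "finite ((\<lambda>X. X \<inter> river d) ` Q)"
    by (rule finite_subset[of _ "Pow (river d)"]) (auto simp: finite_river)
  ultimately have "finite Q"
    using finite_imageD by blast
  have "class_number d * (n + 1) = (\<Sum>X\<in>Q. n + 1)"
    by (simp add: class_number_def Q_def)
  also have "\<dots> \<le> (\<Sum>X\<in>Q. card (X \<inter> river d))"
    by (rule sum_mono) (rule large)
  also have "\<dots> = card (\<Union>X\<in>Q. X \<inter> river d)"
    using \<open>finite Q\<close> disj finite_river by (subst card_UN_disjoint) auto
  also have "\<dots> \<le> card (river d)"
    using finite_river by (intro card_mono) auto
  finally show ?thesis .
qed

subsection \<open>The divisor bound\<close>

definition divisor_count :: "nat \<Rightarrow> nat" where
  "divisor_count n = card {d. d dvd n}"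

lemma divisor_count_1 [simp]: "divisor_count (Suc 0) = 1"
  by (simp add: divisor_count_def)

lemma divisor_count_mult_le:
  assumes "0 < m" "0 < n"
  shows "divisor_count (m * n) \<le> divisor_count m * divisor_count n"
proof -
  have "{d. d dvd m * n} \<subseteq> (\<lambda>(i, j). i * j) ` ({d. d dvd m} \<times> {d. d dvd n})"
    by (auto simp: image_iff dest!: division_decomp)
  then have "card {d. d dvd m * n} \<le> card ((\<lambda>(i, j). i * j) ` ({d. d dvd m} \<times> {d. d dvd n}))"
    using assms by (intro card_mono) auto
  also have "\<dots> \<le> card ({d. d dvd m} \<times> {d. d dvd n})"
    using assms by (intro card_image_le) auto
  finally show ?thesis
    by (simp add: divisor_count_def card_cartesian_product)
qed

lemma divisor_count_prime_power:
  assumes "prime p"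
  shows "divisor_count (p ^ k) = k + 1"
proof -
  have "{d. d dvd p ^ k} = (\<lambda>i. p ^ i) ` {..k}"
    using assms divides_primepow_nat by auto
  moreover have "inj_on (\<lambda>i. p ^ i) {..k}"
    using assms by (auto intro!: inj_onI dest: prime_gt_1_nat)
  ultimately show ?thesis
    by (simp add: divisor_count_def card_image)
qed

lemma Suc_le_exp_bound:
  fixes x :: real
  assumes "1 < x"
  shows "\<exists>C\<ge>1. \<forall>k::nat. real (k + 1) \<le> C * x ^ k"
proof -
  \<comment> \<open>This \<open>C\<close> satisfies \<open>1 \<le> C\<close> and
    \<open>1 \<le> C * (x - 1)\<close>, which turns Bernoulli's \<open>1 + k * (x - 1)\<close> into
    \<open>k + 1\<close>.\<close>
  define C where "C = max 1 (1 / (x - 1))"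
  have "real (k + 1) \<le> C * x ^ k" for k
  proof -
    have "1 + real k * (x - 1) \<le> x ^ k"
      using Bernoulli_inequality[of "x - 1" k] assms by simp
    then have "C * (1 + real k * (x - 1)) \<le> C * x ^ k"
      by (rule mult_left_mono) (simp add: C_def)
    moreover have "1 \<le> C" "1 \<le> C * (x - 1)"
      using assms by (simp_all add: C_def max_def field_simps)
    then have "1 + real k * 1 \<le> C + real k * (C * (x - 1))"
      by (intro add_mono mult_left_mono) auto
    ultimately show ?thesis
      by (simp add: algebra_simps)
  qed
  then show ?thesis
    by (intro exI[of _ C]) (simp add: C_def)
qed

lemma powr_power_swap: "(x ^ k) powr e = (x powr e) ^ k" if "0 < x" for x e :: real
  using that by (induction k) (simp_all add: powr_mult)

text \<open>Each prime factor at most doubles the number of divisors, while it multiplies the right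
  side by at least \<open>2\<close>.\<close>

lemma divisor_count_le_powr_large_primes:
  fixes e :: real
  assumes "0 < e" "0 < n" "\<And>p. prime p \<Longrightarrow> p dvd n \<Longrightarrow> 2 \<le> real p powr e"
  shows "real (divisor_count n) \<le> real n powr e"
  using assms(2,3)
proof (induction n rule: prime_divisors_induct)
  case (factor p n)
  have "real (divisor_count (p * n)) \<le> real (divisor_count p * divisor_count n)"
    using factor by (intro of_nat_mono divisor_count_mult_le) (auto simp: prime_gt_0_nat)
  also have "\<dots> = 2 * real (divisor_count n)"
    using divisor_count_prime_power[OF factor(1), of 1] by simp
  also have "\<dots> \<le> real p powr e * real n powr e"
    using factor by (intro mult_mono) auto
  finally show ?case
    by (simp add: powr_mult)
qed auto

text \<open>
  The primes below \<open>2 powr (1 / e)\<close> are admitted one after the other, each costing a constant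
  factor.
\<close>

lemma divisor_count_le_powr:
  fixes e :: real
  assumes "0 < e"
  shows "\<exists>C>0. \<forall>n>0. real (divisor_count n) \<le> C * real n powr e"
proof -
  define P where "P = nat \<lceil>2 powr (1 / e)\<rceil>"
  have large: "2 \<le> real p powr e" if "P \<le> p" for p
  proof -
    have "2 powr (1 / e) \<le> real p"
      using that unfolding P_def by linarith
    then have "(2 powr (1 / e)) powr e \<le> real p powr e"
      using assms by (intro powr_mono2) auto
    then show ?thesis
      using assms by (simp add: powr_powr)
  qed
  have "1 < (2::real) powr e"
    using assms by simp
  then obtain D :: real where D: "1 \<le> D" "\<And>k. real (k + 1) \<le> D * (2 powr e) ^ k"
    using Suc_le_exp_bound by blast
  \<comment> \<open>Induction on \<open>N\<close>, the primes between \<open>N\<close> and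
    \<open>P\<close> being forbidden; for \<open>N = P\<close> no restriction is left.\<close>
  have "\<exists>C>0. \<forall>n>0. (\<forall>p. prime p \<longrightarrow> p dvd n \<longrightarrow> p < N \<or> P \<le> p) \<longrightarrow>
      real (divisor_count n) \<le> C * real n powr e" for N
  proof (induction N)
    case 0
    show ?case
      using divisor_count_le_powr_large_primes[OF assms] large
      by (intro exI[of _ 1]) auto
  next
    case (Suc N)
    then obtain C where "0 < C" and C: "\<And>n. 0 < n \<Longrightarrow>
        (\<forall>p. prime p \<longrightarrow> p dvd n \<longrightarrow> p < N \<or> P \<le> p) \<Longrightarrow>
        real (divisor_count n) \<le> C * real n powr e"
      by blast
    have "real (divisor_count n) \<le> D * C * real n powr e"
      if n: "0 < n" "\<forall>p. prime p \<longrightarrow> p dvd n \<longrightarrow> p < Suc N \<or> P \<le> p" for n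
    proof (cases "prime N")
      case False
      then have "real (divisor_count n) \<le> C * real n powr e"
        by (intro C) (use n less_Suc_eq in auto)
      also have "\<dots> \<le> D * (C * real n powr e)"
        using D(1) \<open>0 < C\<close> mult_right_mono[of 1 D "C * real n powr e"] by simp
      finally show ?thesis
        by (simp add: mult.assoc)
    next
      case True
      then obtain m where m: "n = N ^ multiplicity N n * m" "\<not> N dvd m"
        using multiplicity_decompose'[of n N] n(1) prime_gt_1_nat[OF True] by auto
      define k where "k = multiplicity N n"
      have nk: "n = N ^ k * m"
        using m(1) k_def by simp
      have "0 < m" "2 \<le> N"
        using m(2) True prime_ge_2_nat by (auto intro: gr0I)
      have "\<forall>p. prime p \<longrightarrow> p dvd m \<longrightarrow> p < N \<or> P \<le> p"
        using n(2) m(2) less_Suc_eq unfolding nk by (metis dvd_mult)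
      then have "real (divisor_count m) \<le> C * real m powr e"
        using C \<open>0 < m\<close> by blast
      moreover have "real (divisor_count (N ^ k)) \<le> D * (real N powr e) ^ k"
      proof -
        have "D * (2 powr e) ^ k \<le> D * (real N powr e) ^ k"
          using D(1) \<open>2 \<le> N\<close> assms
          by (intro mult_left_mono power_mono powr_mono2) auto
        then show ?thesis
          using D(2)[of k] divisor_count_prime_power[OF True, of k] by linarith
      qed
      ultimately have "real (divisor_count (N ^ k)) * real (divisor_count m)
          \<le> (D * (real N powr e) ^ k) * (C * real m powr e)"
        using D(1) by (intro mult_mono) auto
      moreover have "real (divisor_count n) \<le> real (divisor_count (N ^ k) * divisor_count m)"
        unfolding nk using \<open>0 < m\<close> \<open>2 \<le> N\<close> by (intro of_nat_mono divisor_count_mult_le) auto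
      moreover have "real n powr e = (real N powr e) ^ k * real m powr e"
        using \<open>2 \<le> N\<close> by (simp add: nk powr_mult powr_power_swap)
      ultimately show ?thesis
        by (simp add: mult_ac)
    qed
    then show ?case
      using D(1) \<open>0 < C\<close> by (intro exI[of _ "D * C"]) auto
  qed
  from this[of P] show ?thesis
    by (metis not_le)
qed

text \<open>As \<open>b\<^sup>2 < z\<^sup>2 + 3 < (z + 2)\<^sup>2\<close>, there are at most
  \<open>2 * z + 3\<close> values of \<open>b\<close>. For each of them \<open>a\<close> divides
  \<open>d - b\<^sup>2\<close>, and \<open>a\<close> and \<open>b\<close> determine
  \<open>c\<close>.\<close>

lemma card_river_le:
  fixes z :: int
  assumes "1 \<le> z" "0 < e" "0 < C" and C: "\<And>n. 0 < n \<Longrightarrow> real (divisor_count n) \<le> C * real n powr e"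
  shows "real (card (river (z\<^sup>2 + 3))) \<le> (2 * z + 3) * (C * (z\<^sup>2 + 3) powr e)"
proof -
  define d where "d = z\<^sup>2 + 3"
  define D where "D b = {a. 0 < a \<and> a dvd d - b\<^sup>2}" for b :: int
  have pos: "0 < d - b\<^sup>2 \<and> b \<in> {- (z + 1)..z + 1}" if "(a, b, c) \<in> river d" for a b c
  proof -
    have "b\<^sup>2 - d < 0"
      using that by (auto simp: river_def mult_pos_neg)
    moreover have "b\<^sup>2 < (z + 2)\<^sup>2"
      using calculation assms(1) by (simp add: d_def power2_eq_square algebra_simps)
    then have "\<bar>b\<bar> < z + 2"
      using assms(1) abs_le_square_iff[of "z + 2" b] by linarith
    ultimately show ?thesis
      by auto
  qed
  define I where "I = {b \<in> {- (z + 1)..z + 1}. 0 < d - b\<^sup>2}"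
  have cardD: "real (card (D b)) \<le> C * real_of_int d powr e" and finD: "finite (D b)"
    if "b \<in> I" for b
  proof -
    define n where "n = nat (d - b\<^sup>2)"
    have n: "0 < n" "int n = d - b\<^sup>2"
      using that by (auto simp: n_def I_def)
    have "D b \<subseteq> int ` {i. i dvd n}"
    proof
      fix a
      assume "a \<in> D b"
      then have "nat a dvd n" "a = int (nat a)"
        using n(2) by (auto simp: D_def nat_dvd_iff)
      then show "a \<in> int ` {i. i dvd n}"
        by blast
    qed
    moreover have fin: "finite {i. i dvd n}"
      using n(1) by simp
    ultimately have "card (D b) \<le> card (int ` {i. i dvd n})"
      by (intro card_mono) auto
    also have "\<dots> \<le> divisor_count n"
      using card_image_le[OF fin] by (simp add: divisor_count_def)
    finally have "real (card (D b)) \<le> C * real n powr e"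
      using C[OF n(1)] by linarith
    also have "\<dots> \<le> C * real_of_int d powr e"
    proof (intro mult_left_mono powr_mono2)
      have "int n \<le> d"
        using n(2) by simp
      then show "real n \<le> real_of_int d"
        by linarith
    qed (use assms in auto)
    finally show "real (card (D b)) \<le> C * real_of_int d powr e" .
    show "finite (D b)"
      using \<open>D b \<subseteq> _\<close> fin finite_surj by blast
  qed
  have "finite I"
    unfolding I_def by (rule finite_subset[of _ "{- (z + 1)..z + 1}"]) auto
  then have fin: "finite (Sigma I D)"
    using finD by (rule finite_SigmaI)
  have "inj_on (\<lambda>(a, b, c). (b, a)) (river d)"
    by (auto simp: inj_on_def river_def)
  moreover have "(\<lambda>(a, b, c). (b, a)) ` river d \<subseteq> Sigma I D"
  proof
    fix i
    assume "i \<in> (\<lambda>(a, b, c). (b, a)) ` river d"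
    then obtain a b c where abc: "i = (b, a)" "(a, b, c) \<in> river d"
      by auto
    then have "0 < a" "d - b\<^sup>2 = a * (- c)"
      by (auto simp: river_def)
    then show "i \<in> Sigma I D"
      using pos[OF abc(2)] unfolding abc(1) I_def D_def by simp
  qed
  ultimately have "card (river d) \<le> card (Sigma I D)"
    using fin by (metis card_image card_mono)
  also have "\<dots> = (\<Sum>b\<in>I. card (D b))"
    using \<open>finite I\<close> finD by simp
  finally have "real (card (river d)) \<le> (\<Sum>b\<in>I. real (card (D b)))"
    by (metis of_nat_le_iff of_nat_sum)
  also have "\<dots> \<le> real (card I) * (C * real_of_int d powr e)"
    using cardD by (intro sum_bounded_above) auto
  also have "\<dots> \<le> (2 * z + 3) * (C * real_of_int d powr e)"
  proof (intro mult_right_mono)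
    have "card I \<le> card {- (z + 1)..z + 1}"
      by (intro card_mono) (auto simp: I_def)
    then show "real (card I) \<le> real_of_int (2 * z + 3)"
      using assms(1) by simp
  qed (use assms in auto)
  finally show ?thesis
    by (simp add: d_def)
qed

subsection \<open>Counting\<close>

lemma N_U_circ_power_bound:
  assumes "Browning_Wilsch_for_U"
  shows "\<exists>K>0. \<forall>t. real (N_U_circ (2 ^ (t + 1))) \<le> K * real (t + 1) ^ 4"
proof -
  obtain c where "0 < c"
    and "eventually (\<lambda>B. norm (real (N_U_circ B)) \<le> c * norm (ln B ^ (2 + 2))) at_top"
    using assms unfolding Browning_Wilsch_for_U_def by (rule landau_o.bigE)
  then obtain B0 where B0: "\<And>B. B0 \<le> B \<Longrightarrow> real (N_U_circ B) \<le> c * \<bar>ln B ^ 4\<bar>"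
    by (auto simp: eventually_at_top_linorder)
  obtain T where T: "B0 < 2 ^ T"
    using real_arch_pow[of 2 B0] by auto
  \<comment> \<open>The finitely many exponents below \<open>T\<close>, where the asymptotic bound
    says nothing, are absorbed into the constant.\<close>
  define s where "s = (\<Sum>t<T. real (N_U_circ (2 ^ (t + 1))))"
  have s0: "0 \<le> s"
    unfolding s_def by (intro sum_nonneg) auto
  have "real (N_U_circ (2 ^ (t + 1))) \<le> (c + s) * real (t + 1) ^ 4" for t
  proof (cases "t < T")
    case True
    have "real (N_U_circ (2 ^ (t + 1))) \<le> s"
      unfolding s_def using True
      by (intro member_le_sum[where f = "\<lambda>t. real (N_U_circ (2 ^ (t + 1)))"]) auto
    also have "\<dots> \<le> (c + s) * 1"
      using \<open>0 < c\<close> by simp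
    also have "\<dots> \<le> (c + s) * real (t + 1) ^ 4"
      using \<open>0 < c\<close> s0 by (intro mult_left_mono one_le_power) auto
    finally show ?thesis .
  next
    case False
    then have "(2::real) ^ T \<le> 2 ^ (t + 1)"
      by (intro power_increasing) auto
    then have "real (N_U_circ (2 ^ (t + 1))) \<le> c * \<bar>ln (2 ^ (t + 1)) ^ 4\<bar>"
      using T by (intro B0) linarith
    also have "\<dots> = c * (real (t + 1) * ln 2) ^ 4"
      by (subst ln_realpow) auto
    also have "\<dots> \<le> c * (real (t + 1) * 1) ^ 4"
      using \<open>0 < c\<close> ln_2_less_1 by (intro mult_left_mono power_mono) auto
    also have "\<dots> \<le> (c + s) * real (t + 1) ^ 4"
      using s0 by (simp add: mult_right_mono)
    finally show ?thesis .
  qed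
  then show ?thesis
    using \<open>0 < c\<close> s0 by (intro exI[of _ "c + s"]) auto
qed

lemma finite_U_circ_box: "finite {(y, u, z) \<in> U_circ. real_of_int (max \<bar>y\<bar> (max \<bar>u\<bar> \<bar>z\<bar>)) \<le> B}"
proof (rule finite_subset)
  show "{(y, u, z) \<in> U_circ. real_of_int (max \<bar>y\<bar> (max \<bar>u\<bar> \<bar>z\<bar>)) \<le> B}
      \<subseteq> {-\<lfloor>B\<rfloor>..\<lfloor>B\<rfloor>} \<times> {-\<lfloor>B\<rfloor>..\<lfloor>B\<rfloor>} \<times> {-\<lfloor>B\<rfloor>..\<lfloor>B\<rfloor>}"
    by (auto simp flip: le_floor_iff)
qed simp

text \<open>
  Completing the square turns the equation of \<open>U\<close> into \<open>(y - z u)\<^sup>2 - (z\<^sup>2 + 3) u\<^sup>2 = 1\<close>.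
\<close>

lemma pell_gives_U_circ_point:
  assumes "1 \<le> z" "\<not> 3 dvd z" "pell_solvable_upto (z\<^sup>2 + 3) t"
  shows "\<exists>y u. (y, u, z) \<in> U_circ \<and> real_of_int (max \<bar>y\<bar> (max \<bar>u\<bar> \<bar>z\<bar>)) \<le> 2 ^ (t + 1)"
proof -
  obtain x u where xu: "0 < x" "x \<le> 2 ^ t" "u \<noteq> 0" "x\<^sup>2 - (z\<^sup>2 + 3) * u\<^sup>2 = 1"
    using assms(3) unfolding pell_solvable_upto_def by blast
  have "(x + z * u, u, z) \<in> U_points"
    using xu(4) by (simp add: U_points_def algebra_simps power2_eq_square)
  then have "(x + z * u, u, z) \<in> U_circ"
    using U_circI xu(3) assms(2) by blast
  \<comment> \<open>Since \<open>\<bar>z * u\<bar> \<le> x\<close>, the coordinate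
    \<open>y = x + z * u\<close> is at most \<open>2 * x\<close>; hence the exponent
    \<open>t + 1\<close>.\<close>
  moreover have "(z * u)\<^sup>2 \<le> x\<^sup>2"
    using xu(4) zero_le_power2[of u] by (simp add: power_mult_distrib algebra_simps)
  then have zu: "\<bar>z * u\<bar> \<le> x"
    using xu(1) abs_le_square_iff[of "z * u" x] by simp
  moreover have "\<bar>u\<bar> \<le> \<bar>z * u\<bar>" "\<bar>z\<bar> \<le> \<bar>z * u\<bar>"
    using assms(1) xu(3) mult_right_mono[of 1 "\<bar>z\<bar>" "\<bar>u\<bar>"] mult_left_mono[of 1 "\<bar>u\<bar>" "\<bar>z\<bar>"]
    by (simp_all add: abs_mult)
  ultimately have "max \<bar>x + z * u\<bar> (max \<bar>u\<bar> \<bar>z\<bar>) \<le> 2 ^ (t + 1)"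
    using xu(1,2) by simp
  then have "real_of_int (max \<bar>x + z * u\<bar> (max \<bar>u\<bar> \<bar>z\<bar>)) \<le> real_of_int (2 ^ (t + 1))"
    by (simp only: of_int_le_iff)
  then show ?thesis
    using \<open>(x + z * u, u, z) \<in> U_circ\<close> by auto
qed

text \<open>Points over different \<open>z\<close> are different, so projecting the box to
  \<open>z\<close> covers \<open>S\<close>.\<close>

lemma card_pell_solvable_le:
  assumes "finite S" "\<And>z. z \<in> S \<Longrightarrow> 1 \<le> z \<and> \<not> 3 dvd z \<and> pell_solvable_upto (z\<^sup>2 + 3) t"
  shows "card S \<le> N_U_circ (2 ^ (t + 1))"
proof -
  let ?P = "{(y, u, z) \<in> U_circ. real_of_int (max \<bar>y\<bar> (max \<bar>u\<bar> \<bar>z\<bar>)) \<le> 2 ^ (t + 1)}"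
  have "S \<subseteq> (\<lambda>(y, u, z). z) ` ?P"
  proof
    fix z
    assume "z \<in> S"
    then obtain y u where "(y, u, z) \<in> ?P"
      using assms(2) pell_gives_U_circ_point[of z t] by blast
    then show "z \<in> (\<lambda>(y, u, z). z) ` ?P"
      by force
  qed
  then have "card S \<le> card ?P"
    by (rule surj_card_le[OF finite_U_circ_box])
  then show ?thesis
    by (simp add: N_U_circ_def)
qed

section \<open>Class numbers for square-free \<open>z\<^sup>2 + 3\<close> and their sum\<close>

lemma not_square_if_squarefree:
  fixes z :: int
  assumes "z \<noteq> 0" "squarefree (z\<^sup>2 + 3)"
  shows "r\<^sup>2 \<noteq> z\<^sup>2 + 3"
proof
  assume r: "r\<^sup>2 = z\<^sup>2 + 3"
  then have "r dvd 1"
    using assms(2) unfolding squarefree_def by (metis dvd_refl)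
  then have "r\<^sup>2 = 1"
    by (auto simp: zdvd1_eq abs_if power2_eq_square split: if_splits)
  then show False
    using r zero_le_power2[of z] by linarith
qed

text \<open>This permits \<open>n = 0\<close> in the period bound, which is then the trivial bound
  for the class number.\<close>

lemma not_pell_solvable_upto_0:
  assumes "0 < d"
  shows "\<not> pell_solvable_upto d 0"
proof
  assume "pell_solvable_upto d 0"
  then obtain x u :: int where "0 < x" "x \<le> 1" "u \<noteq> 0" "x\<^sup>2 - d * u\<^sup>2 = 1"
    unfolding pell_solvable_upto_def by auto
  moreover from this have "x = 1"
    by simp
  ultimately show False
    using assms by simp
qed

lemma class_number_le_powr:
  fixes z :: int and Z e C :: real
  assumes z: "1 \<le> z" "real_of_int z \<le> Z" "squarefree (z\<^sup>2 + 3)"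
    and "0 < e" "0 < C" and C: "\<And>n. 0 < n \<Longrightarrow> real (divisor_count n) \<le> C * real n powr e"
    and "\<not> pell_solvable_upto (z\<^sup>2 + 3) n"
  shows "real (class_number (z\<^sup>2 + 3)) \<le> 5 * C * 4 powr e * Z powr (1 + 2 * e) / real (n + 1)"
proof -
  have Z: "1 \<le> Z"
    using z by linarith
  have "class_number (z\<^sup>2 + 3) * (n + 1) \<le> card (river (z\<^sup>2 + 3))"
    using z(1) by (intro class_number_le_river not_square_if_squarefree z(3) assms(7) add_nonneg_pos) auto
  then have "real (class_number (z\<^sup>2 + 3)) * real (n + 1) \<le> real (card (river (z\<^sup>2 + 3)))"
    by (metis of_nat_le_iff of_nat_mult)
  also have "\<dots> \<le> (2 * z + 3) * (C * (z\<^sup>2 + 3) powr e)"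
    using card_river_le[OF z(1) assms(4,5) C] .
  \<comment> \<open>For \<open>Z \<ge> 1\<close> and \<open>z \<le> Z\<close> one has
    \<open>2 * z + 3 \<le> 5 * Z\<close> and
    \<open>z\<^sup>2 + 3 \<le> 4 * Z\<^sup>2\<close>.\<close>
  also have "\<dots> \<le> (5 * Z) * (C * (4 * Z\<^sup>2) powr e)"
  proof (intro mult_mono powr_mono2)
    have "(real_of_int z)\<^sup>2 \<le> Z\<^sup>2" "1 \<le> Z\<^sup>2"
      using z Z by (auto intro!: power_mono)
    then show "real_of_int (z\<^sup>2 + 3) \<le> 4 * Z\<^sup>2"
      by simp
  qed (use z Z assms(4,5) in auto)
  also have "\<dots> = 5 * C * 4 powr e * Z powr (1 + 2 * e)"
    using Z by (simp add: powr_mult powr_add powr_powr flip: powr_numeral)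
  finally show ?thesis
    by (simp add: field_simps)
qed

lemma ceiling_powr_bounds:
  fixes Z :: real
  assumes "1 \<le> Z" "0 \<le> a"
  shows "Z powr a \<le> real (nat \<lceil>Z powr a\<rceil> + 1)" "real (nat \<lceil>Z powr a\<rceil> + 1) \<le> 3 * Z powr a"
proof -
  have "1 \<le> Z powr a"
    using assms by (simp add: ge_one_powr_ge_zero)
  then show "Z powr a \<le> real (nat \<lceil>Z powr a\<rceil> + 1)" "real (nat \<lceil>Z powr a\<rceil> + 1) \<le> 3 * Z powr a"
    by linarith+
qed

theorem theorem1p6:
  assumes "Browning_Wilsch_for_U"
  shows "\<exists>K::real. \<forall>Z::real. Z \<ge> 2 \<longrightarrow>
    (\<Sum>z | 1 \<le> z \<and> real_of_int z \<le> Z \<and> \<not> 3 dvd z \<and> squarefree (z\<^sup>2 + 3).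
        real (class_number (z\<^sup>2 + 3)))
      \<le> K * (Z powr (9/5) * ln Z powr (3/5))"
proof -
  obtain N where "0 < N" and N: "\<And>t. real (N_U_circ (2 ^ (t + 1))) \<le> N * real (t + 1) ^ 4"
    using N_U_circ_power_bound[OF assms] by blast
  \<comment> \<open>Small enough for \<open>31/40 + 1 + 2 * e = 359/200\<close> to stay below
    \<open>9/5\<close>.\<close>
  define e :: real where "e = 1 / 100"
  have "0 < e"
    by (simp add: e_def)
  then obtain C where "0 < C" and C: "\<And>n. 0 < n \<Longrightarrow> real (divisor_count n) \<le> C * real n powr e"
    using divisor_count_le_powr by blast
  define A where "A = 5 * C * 4 powr e"
  have "0 < A"
    using \<open>0 < C\<close> by (simp add: A_def)
  \<comment> \<open>The ranges \<open>S1\<close> and \<open>S2\<close> contribute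
    \<open>81 * N\<close> each, with \<open>81 = 3 ^ 4\<close> from rounding the thresholds, and
    \<open>S3\<close> contributes \<open>1\<close>.\<close>
  define K where "K = A * (162 * N + 1)"
  have "0 < K"
    using \<open>0 < A\<close> \<open>0 < N\<close> by (simp add: K_def)
  have "(\<Sum>z | 1 \<le> z \<and> real_of_int z \<le> Z \<and> \<not> 3 dvd z \<and> squarefree (z\<^sup>2 + 3).
        real (class_number (z\<^sup>2 + 3)))
      \<le> K / ln 2 powr (3/5) * (Z powr (9/5) * ln Z powr (3/5))" if Z: "2 \<le> Z" for Z :: real
  proof -
    define S where "S = {z::int. 1 \<le> z \<and> real_of_int z \<le> Z \<and> \<not> 3 dvd z \<and> squarefree (z\<^sup>2 + 3)}"
    have S_sub: "S \<subseteq> {1..\<lfloor>Z\<rfloor>}"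
      by (auto simp: S_def le_floor_iff)
    then have finS: "finite S"
      by (rule finite_subset) simp
    have "card S \<le> card {1..\<lfloor>Z\<rfloor>}"
      using S_sub by (intro card_mono) auto
    then have cardS: "real (card S) \<le> Z"
      using Z by (simp add: le_nat_iff) linarith
    define h where "h z = real (class_number (z\<^sup>2 + 3))" for z :: int
    define M where "M = A * Z powr (1 + 2 * e)"
    have "0 < M"
      using \<open>0 < A\<close> Z by (simp add: M_def)
    have h_le: "h z \<le> M / real (n + 1)" if "z \<in> S" "\<not> pell_solvable_upto (z\<^sup>2 + 3) n" for z n
      unfolding h_def M_def A_def
      using that class_number_le_powr[OF _ _ _ \<open>0 < e\<close> \<open>0 < C\<close> C] by (simp add: S_def)
    \<comment> \<open>Thresholds \<open>Z powr a\<close> and \<open>Z powr b\<close> give the three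
      ranges the exponents \<open>4 * a\<close>, \<open>4 * b - a\<close> and \<open>1 - b\<close>
      relative to \<open>M\<close>, here \<open>3/5\<close>, \<open>3/4\<close> and
      \<open>31/40\<close>. A single threshold would balance at \<open>4 * a = 1 - a = 4/5\<close>,
      a total of \<open>9/5 + 2 * e\<close>; the second one makes up for the loss in the divisor
      bound.\<close>
    define L1 L2 where L: "L1 = nat \<lceil>Z powr (3/20)\<rceil>" "L2 = nat \<lceil>Z powr (9/40)\<rceil>"
    have L1: "Z powr (3/20) \<le> real (L1 + 1)" "real (L1 + 1) \<le> 3 * Z powr (3/20)"
      and L2: "Z powr (9/40) \<le> real (L2 + 1)" "real (L2 + 1) \<le> 3 * Z powr (9/40)"
      unfolding L using Z by (intro ceiling_powr_bounds; simp)+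
    have quartic: "N * real (t + 1) ^ 4 \<le> 81 * N * Z powr (4 * a)"
      if "real (t + 1) \<le> 3 * Z powr a" for t a
    proof -
      have "real (t + 1) ^ 4 \<le> (3 * Z powr a) ^ 4"
        using that by (intro power_mono) auto
      also have "\<dots> = 81 * Z powr (4 * a)"
        using Z by (simp add: power_mult_distrib powr_power mult.commute)
      finally show ?thesis
        using \<open>0 < N\<close> by simp
    qed
    define S1 S2 S3 where
      S: "S1 = {z \<in> S. pell_solvable_upto (z\<^sup>2 + 3) L1}"
      "S2 = {z \<in> S. \<not> pell_solvable_upto (z\<^sup>2 + 3) L1 \<and> pell_solvable_upto (z\<^sup>2 + 3) L2}"
      "S3 = {z \<in> S. \<not> pell_solvable_upto (z\<^sup>2 + 3) L1 \<and> \<not> pell_solvable_upto (z\<^sup>2 + 3) L2}"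
    have fin: "finite S1" "finite S2" "finite S3"
      using finS by (simp_all add: S)
    have "S = S1 \<union> (S2 \<union> S3)"
      by (auto simp: S)
    moreover have "S1 \<inter> (S2 \<union> S3) = {}" "S2 \<inter> S3 = {}"
      by (auto simp: S)
    ultimately have "sum h S = sum h S1 + (sum h S2 + sum h S3)"
      using fin by (simp add: sum.union_disjoint)
    moreover have "sum h S1 \<le> 81 * N * Z powr (31/40) * M"
    proof -
      have "h z \<le> M" if "z \<in> S1" for z
        using h_le[of z 0] that not_pell_solvable_upto_0[of "z\<^sup>2 + 3"] zero_le_power2[of z]
        by (auto simp: S simp del: zero_le_power2)
      then have "sum h S1 \<le> real (card S1) * M"
        by (rule sum_bounded_above)
      moreover have "real (card S1) \<le> N * real (L1 + 1) ^ 4"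
        using card_pell_solvable_le[OF fin(1), of L1] N[of L1] by (simp add: S S_def)
      moreover have "Z powr (4 * (3/20)) \<le> Z powr (31/40)"
        using Z by (intro powr_mono) auto
      then have "81 * N * Z powr (4 * (3/20)) \<le> 81 * N * Z powr (31/40)"
        using \<open>0 < N\<close> by simp
      ultimately have "real (card S1) \<le> 81 * N * Z powr (31/40)"
        using quartic[OF L1(2)] by linarith
      then show ?thesis
        using \<open>sum h S1 \<le> real (card S1) * M\<close> \<open>0 < M\<close>
        by (meson mult_right_mono order_less_imp_le order_trans)
    qed
    moreover have "sum h S2 \<le> 81 * N * Z powr (31/40) * M"
    proof -
      have "h z \<le> M / Z powr (3/20)" if "z \<in> S2" for z
      proof -
        have "h z \<le> M / real (L1 + 1)"
          using h_le that by (simp add: S)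
        also have "\<dots> \<le> M / Z powr (3/20)"
          using \<open>0 < M\<close> L1(1) Z by (intro divide_left_mono) auto
        finally show ?thesis .
      qed
      then have "sum h S2 \<le> real (card S2) * (M / Z powr (3/20))"
        by (rule sum_bounded_above)
      moreover have "real (card S2) \<le> N * real (L2 + 1) ^ 4"
        using card_pell_solvable_le[OF fin(2), of L2] N[of L2] by (simp add: S S_def)
      then have "real (card S2) \<le> 81 * N * Z powr (4 * (9/40))"
        using quartic[OF L2(2)] by linarith
      then have "real (card S2) * (M / Z powr (3/20)) \<le> 81 * N * Z powr (4 * (9/40)) * (M / Z powr (3/20))"
        using \<open>0 < M\<close> by (intro mult_right_mono) auto
      moreover have "Z powr (4 * (9/40)) / Z powr (3/20) = Z powr (3/4)"
        using Z by (simp flip: powr_diff)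
      then have "81 * N * Z powr (4 * (9/40)) * (M / Z powr (3/20)) = 81 * N * Z powr (3/4) * M"
        using Z by (simp add: field_simps)
      moreover have "Z powr (3/4) \<le> Z powr (31/40)"
        using Z by (intro powr_mono) auto
      then have "81 * N * Z powr (3/4) * M \<le> 81 * N * Z powr (31/40) * M"
        using \<open>0 < M\<close> \<open>0 < N\<close> by simp
      ultimately show ?thesis
        by linarith
    qed
    moreover have "sum h S3 \<le> Z powr (31/40) * M"
    proof -
      have "h z \<le> M / Z powr (9/40)" if "z \<in> S3" for z
      proof -
        have "h z \<le> M / real (L2 + 1)"
          using h_le that by (simp add: S)
        also have "\<dots> \<le> M / Z powr (9/40)"
          using \<open>0 < M\<close> L2(1) Z by (intro divide_left_mono) auto
        finally show ?thesis .
      qed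
      then have "sum h S3 \<le> real (card S3) * (M / Z powr (9/40))"
        by (rule sum_bounded_above)
      also have "\<dots> \<le> Z powr 1 * (M / Z powr (9/40))"
      proof (rule mult_right_mono)
        have "card S3 \<le> card S"
          using finS by (intro card_mono) (auto simp: S)
        then show "real (card S3) \<le> Z powr 1"
          using cardS Z by simp
      qed (use \<open>0 < M\<close> in auto)
      also have "\<dots> = Z powr (1 - 9/40) * M"
        unfolding powr_diff by simp
      finally show ?thesis
        by simp
    qed
    ultimately have "sum h S \<le> (162 * N + 1) * Z powr (31/40) * M"
      by (simp add: algebra_simps)
    also have "\<dots> = K * Z powr (359/200)"
      by (simp add: K_def M_def e_def mult_ac flip: powr_add)
    also have "\<dots> \<le> K * Z powr (9/5)"
      using Z \<open>0 < K\<close> by (intro mult_left_mono powr_mono) auto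
    \<comment> \<open>The power of \<open>Z\<close> is already saved, so the logarithmic factor only
      has to be bounded below, by its value at \<open>Z = 2\<close>.\<close>
    also have "\<dots> \<le> K * Z powr (9/5) * (ln Z powr (3/5) / ln 2 powr (3/5))"
    proof -
      have "ln 2 powr (3/5) \<le> ln Z powr (3/5)"
        using Z by (intro powr_mono2) auto
      then have "1 \<le> ln Z powr (3/5) / ln 2 powr (3/5)"
        by simp
      then show ?thesis
        using \<open>0 < K\<close> mult_left_mono[of 1 "ln Z powr (3/5) / ln 2 powr (3/5)" "K * Z powr (9/5)"]
        by simp
    qed
    finally show ?thesis
      by (simp add: S_def h_def)
  qed
  then show ?thesis
    by blast
qed

end
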